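(* Let $k\ge 1$ be a fixed integer and $0\le\beta<1$ a fixed real number. Let $m=m(n)$ satisfy $m=\omega\!\left(n^{(1-\beta)k}\right)$, i.e. $m/n^{(1-\beta)k}\to\infty$ as $n\to\infty$. Then a scale-free random formula over $n$ variables with exponent $\beta$ and $m$ clauses of size $k$ is unsatisfiable with probability $1-o(1)$ as $n\to\infty$.
   Context: Scale-free random $k$-SAT formulas. Variables are $x_1,\dots,x_n$; a literal is $x_i$ or $\neg x_i$. A clause of size $k$ is a disjunction (regarded as a set) of $k$ literals on $k$ pairwise distinct variables, so there are $2^k\binom{n}{k}$ clauses. Given $n,m,k$ and a real exponent $\beta\ge 0$, a scale-free random formula is a conjunction (multiset) of $m$ clauses sampled independently (repetitions allowed), each clause being sampled with probability proportional to $\prod_{j=1}^k i_j^{-\beta}$, where $x_{i_1},\dots,x_{i_k}$ are the variables of the clause. Equivalently: sample $k$ variables independently with $P(x_i)=i^{-\beta}/\sum_{j=1}^n j^{-\beta}$, negate each independently with probability $1/2$, and reject and resample the clause if some variable is repeated. *)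

theory Defs
  imports "HOL-Probability.Probability" "HOL-Library.Landau_Symbols"
begin

datatype lit = Pos (var: nat) | Neg (var: nat)

type_synonym clause = "lit set"
type_synonym formula = "clause multiset"

definition clauses :: "nat \<Rightarrow> nat \<Rightarrow> clause set" where
  "clauses n k = {C. finite C \<and> card C = k \<and> inj_on var C \<and> var ` C \<subseteq> {1..n}}"

definition clause_weight :: "real \<Rightarrow> clause \<Rightarrow> real" where
  "clause_weight \<beta> C = (\<Prod>l\<in>C. real (var l) powr (- \<beta>))"

(* There are no clauses when n < k, and this distribution is then a junk value;
   lemma pmf_scale_free_clause below shows that it is the intended one when k \<le> n. *)
definition scale_free_clause :: "nat \<Rightarrow> nat \<Rightarrow> real \<Rightarrow> clause pmf" where
  "scale_free_clause n k \<beta> = embed_pmf (\<lambda>C. if C \<in> clauses n k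
     then clause_weight \<beta> C / (\<Sum>D\<in>clauses n k. clause_weight \<beta> D) else 0)"

definition scale_free_formula :: "nat \<Rightarrow> nat \<Rightarrow> nat \<Rightarrow> real \<Rightarrow> formula pmf" where
  "scale_free_formula n m k \<beta> = map_pmf mset (replicate_pmf m (scale_free_clause n k \<beta>))"

fun lit_true :: "(nat \<Rightarrow> bool) \<Rightarrow> lit \<Rightarrow> bool" where
  "lit_true \<sigma> (Pos i) = \<sigma> i"
| "lit_true \<sigma> (Neg i) = (\<not> \<sigma> i)"

definition satisfiable :: "formula \<Rightarrow> bool" where
  "satisfiable F \<longleftrightarrow> (\<exists>\<sigma>. \<forall>C\<in>#F. \<exists>l\<in>C. lit_true \<sigma> l)"

lemma finite_clauses: "finite (clauses n k)"
proof (rule finite_subset)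
  show "clauses n k \<subseteq> Pow (Pos ` {1..n} \<union> Neg ` {1..n})"
  proof (intro subsetI PowI)
    fix C l assume "C \<in> clauses n k" "l \<in> C"
    then have "var l \<in> {1..n}" by (auto simp: clauses_def)
    then show "l \<in> Pos ` {1..n} \<union> Neg ` {1..n}" by (cases l) auto
  qed
qed simp

lemma clauses_nonempty:
  assumes "k \<le> n"
  shows "clauses n k \<noteq> {}"
proof -
  have "Pos ` {1..k} \<in> clauses n k"
    using assms by (auto simp: clauses_def card_image inj_on_def)
  then show ?thesis by blast
qed

lemma clause_weight_pos: "C \<in> clauses n k \<Longrightarrow> clause_weight \<beta> C > 0"
  unfolding clause_weight_def by (rule prod_pos) (force simp: clauses_def)

lemma pmf_scale_free_clause:
  assumes "k \<le> n"
  shows "pmf (scale_free_clause n k \<beta>) C = (if C \<in> clauses n k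
     then clause_weight \<beta> C / (\<Sum>D\<in>clauses n k. clause_weight \<beta> D) else 0)"
proof -
  let ?S = "\<Sum>D\<in>clauses n k. clause_weight \<beta> D"
  let ?f = "\<lambda>C. if C \<in> clauses n k then clause_weight \<beta> C / ?S else 0"
  have S: "?S > 0"
    using finite_clauses clauses_nonempty[OF assms] clause_weight_pos by (intro sum_pos) auto
  have nonneg: "?f C \<ge> 0" for C
    using S clause_weight_pos[of C n k \<beta>] by auto
  have "(\<integral>\<^sup>+C. ennreal (?f C) \<partial>count_space UNIV) = (\<Sum>C\<in>clauses n k. ennreal (?f C))"
    by (rule nn_integral_count_space'[OF finite_clauses]) auto
  also have "\<dots> = ennreal (\<Sum>C\<in>clauses n k. ?f C)"
    by (rule sum_ennreal) (rule nonneg)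
  also have "(\<Sum>C\<in>clauses n k. ?f C) = 1"
    using S by (simp add: sum_divide_distrib[symmetric])
  finally have "(\<integral>\<^sup>+C. ennreal (?f C) \<partial>count_space UNIV) = 1"
    by simp
  with nonneg show ?thesis
    unfolding scale_free_clause_def by (rule pmf_embed_pmf)
qed

end

theory Submission
  imports Defs
begin

text \<open>Each of the \<open>2 ^ k\<close> clauses on the variables \<open>1, \<dots>, k\<close> has constant weight, while the total
  weight of all clauses is \<open>O(n powr ((1 - \<beta>) * k))\<close>. Among \<open>\<omega>(n powr ((1 - \<beta>) * k))\<close> independent
  clauses all of these therefore occur with probability \<open>1 - o(1)\<close>, and together they exclude every
  assignment.\<close>

text \<open>The left side is the \<open>k\<close>-th elementary symmetric polynomial in the values
  of \<open>f\<close>. Expanding the power on the right produces each of its terms at least once,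
  plus nonnegative terms. The induction on \<open>A\<close> reproduces this through the recurrence
  for adding one element.\<close>

lemma sum_prod_subsets_le_power:
  fixes f :: "'a \<Rightarrow> real"
  assumes "finite A" "\<And>x. x \<in> A \<Longrightarrow> f x \<ge> 0"
  shows "(\<Sum>D | D \<subseteq> A \<and> card D = k. prod f D) \<le> sum f A ^ k"
  using assms
proof (induction A arbitrary: k rule: finite_induct)
  case empty
  have "{D :: 'a set. D = {} \<and> card D = k} = (if k = 0 then {{}} else {})" by auto
  moreover have "card \<dots> \<le> (0 :: real) ^ k" by simp
  moreover have "(\<Sum>D | D = {} \<and> card D = k. prod f D) = card {D :: 'a set. D = {} \<and> card D = k}"
    by simp
  ultimately show ?case by (simp only: subset_empty sum.empty)
next
  case (insert a A)
  have nonneg: "f a \<ge> 0" "sum f A \<ge> 0"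
    using insert.prems by (auto intro: sum_nonneg)
  show ?case
  proof (cases k)
    case 0
    have "{D. D \<subseteq> insert a A \<and> card D = 0} = {{}}"
      using insert.hyps(1) by (auto dest: finite_subset simp: card_eq_0_iff)
    then show ?thesis using 0 by simp
  next
    case (Suc j)
    let ?E = "\<lambda>j. {D. D \<subseteq> A \<and> card D = j}"
    have fin: "finite (?E j)" for j
      using insert.hyps(1) by simp
    \<comment> \<open>Classify the subsets by whether they contain \<open>a\<close>; those that do
      arise by adding \<open>a\<close> to a subset of \<open>A\<close> of size
      \<open>j\<close>.\<close>
    have split: "{D. D \<subseteq> insert a A \<and> card D = Suc j} = ?E (Suc j) \<union> insert a ` ?E j"
    proof (intro equalityI subsetI)
      fix D assume D: "D \<in> {D. D \<subseteq> insert a A \<and> card D = Suc j}"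
      show "D \<in> ?E (Suc j) \<union> insert a ` ?E j"
      proof (cases "a \<in> D")
        case True
        then have "D - {a} \<in> ?E j" "D = insert a (D - {a})"
          using D by auto
        then show ?thesis by blast
      qed (use D in auto)
    next
      fix D assume "D \<in> ?E (Suc j) \<union> insert a ` ?E j"
      moreover have "card (insert a D') = Suc (card D')" if "D' \<subseteq> A" for D'
        using that insert.hyps by (intro card_insert_disjoint) (auto dest: finite_subset)
      ultimately show "D \<in> {D. D \<subseteq> insert a A \<and> card D = Suc j}"
        by auto
    qed
    have inj: "inj_on (insert a) (?E j)"
      using insert.hyps(2) by (auto simp: inj_on_def)
    have step: "prod f (insert a D) = f a * prod f D" if "D \<in> ?E j" for D
      using that insert.hyps by (subst prod.insert) (auto dest: finite_subset)
    have "(\<Sum>D | D \<subseteq> insert a A \<and> card D = Suc j. prod f D)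
        = (\<Sum>D\<in>?E (Suc j). prod f D) + (\<Sum>D\<in>insert a ` ?E j. prod f D)"
      unfolding split using fin insert.hyps(2) by (intro sum.union_disjoint) auto
    also have "(\<Sum>D\<in>insert a ` ?E j. prod f D) = f a * (\<Sum>D\<in>?E j. prod f D)"
      unfolding sum_distrib_left sum.reindex[OF inj] o_def using step by (intro sum.cong) auto
    also have "(\<Sum>D\<in>?E (Suc j). prod f D) + \<dots> \<le> sum f A ^ Suc j + f a * sum f A ^ j"
      using nonneg insert.prems by (intro add_mono mult_left_mono insert.IH) auto
    also have "\<dots> = (f a + sum f A) * sum f A ^ j"
      by (simp add: algebra_simps)
    also have "\<dots> \<le> (f a + sum f A) * (f a + sum f A) ^ j"
      using nonneg by (intro mult_left_mono power_mono) auto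
    finally show ?thesis
      using Suc insert.hyps by simp
  qed
qed

text \<open>The right side is the integral of \<open>x powr (-\<beta>)\<close> from 0 to
  \<open>n\<close>. Instead of integrating, the induction shows that its increment from
  \<open>n\<close> to \<open>Suc n\<close> is at least the new summand.\<close>

lemma sum_powr_minus_le:
  fixes \<beta> :: real
  assumes "0 \<le> \<beta>" "\<beta> < 1"
  shows "(\<Sum>i=1..n. real i powr (-\<beta>)) \<le> real n powr (1 - \<beta>) / (1 - \<beta>)"
proof (induction n)
  case (Suc n)
  let ?a = "1 - \<beta>" and ?N = "real (Suc n)"
  \<comment> \<open>Weighted AM-GM with weights \<open>1 - \<beta>\<close> and
    \<open>\<beta>\<close>. It needs positive arguments, so \<open>n = 0\<close> is separate; there
    the left side vanishes because \<open>0 powr ?a = 0\<close>.\<close>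
  have "(real n / ?N) powr ?a * 1 powr \<beta> \<le> ?a * (real n / ?N) + \<beta> * 1"
    using assms by (cases "n = 0") (simp, intro Youngs_inequality_0, auto)
  \<comment> \<open>Since \<open>n / ?N = 1 - 1 / ?N\<close> and the two weights add up to 1, the
    right side collapses.\<close>
  then have "real n powr ?a / ?N powr ?a \<le> 1 - ?a / ?N"
    by (simp add: powr_divide field_simps)
  then have "real n powr ?a \<le> (1 - ?a / ?N) * ?N powr ?a"
    by (simp add: pos_divide_le_eq)
  also have "\<dots> = ?N powr ?a - ?a * ?N powr (-\<beta>)"
  proof -
    have "?N powr ?a = ?N * ?N powr (-\<beta>)"
      using powr_add[of ?N 1 "-\<beta>"] by simp
    then show ?thesis by (simp add: field_simps)
  qed
  finally have "?a * ?N powr (-\<beta>) \<le> ?N powr ?a - real n powr ?a"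
    by linarith
  then have "?N powr (-\<beta>) \<le> (?N powr ?a - real n powr ?a) / ?a"
    using assms by (simp add: pos_le_divide_eq mult.commute)
  then have "real n powr ?a / ?a + ?N powr (-\<beta>) \<le> ?N powr ?a / ?a"
    unfolding diff_divide_distrib by linarith
  with Suc.IH show ?case by simp
qed simp

text \<open>Enlarging the range from clauses to all sets of \<open>k\<close> literals, complementary
  pairs included, turns the total weight into an elementary symmetric polynomial. Each variable
  supplies two literals of equal weight, whence the factor 2.\<close>

lemma sum_clause_weight_le:
  assumes "0 \<le> \<beta>" "\<beta> < 1" "n > 0"
  shows "(\<Sum>D\<in>clauses n k. clause_weight \<beta> D)
    \<le> (2 / (1 - \<beta>)) ^ k * real n powr ((1 - \<beta>) * real k)"
proof -
  let ?w = "\<lambda>l. real (var l) powr (-\<beta>)"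
  let ?L = "Pos ` {1..n} \<union> Neg ` {1..n}"
  have sub: "clauses n k \<subseteq> {D. D \<subseteq> ?L \<and> card D = k}"
  proof safe
    fix D l assume D: "D \<in> clauses n k" "l \<in> D" "l \<notin> Neg ` {1..n}"
    then show "l \<in> Pos ` {1..n}" by (cases l) (force simp: clauses_def)+
  qed (simp add: clauses_def)
  have "(\<Sum>D\<in>clauses n k. clause_weight \<beta> D) \<le> (\<Sum>D | D \<subseteq> ?L \<and> card D = k. prod ?w D)"
    unfolding clause_weight_def using sub by (intro sum_mono2) (auto intro: prod_nonneg)
  also have "\<dots> \<le> sum ?w ?L ^ k"
    by (rule sum_prod_subsets_le_power) auto
  also have "sum ?w ?L = sum ?w (Pos ` {1..n}) + sum ?w (Neg ` {1..n})"
    by (rule sum.union_disjoint) auto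
  also have "\<dots> = 2 * (\<Sum>i=1..n. real i powr (-\<beta>))"
    by (simp add: sum.reindex inj_on_def)
  also have "\<dots> ^ k \<le> (2 * (real n powr (1 - \<beta>) / (1 - \<beta>))) ^ k"
    using sum_powr_minus_le[OF assms(1,2)] by (intro power_mono mult_left_mono) (auto intro: sum_nonneg)
  also have "\<dots> = (2 / (1 - \<beta>)) ^ k * (real n powr (1 - \<beta>)) ^ k"
    by (simp flip: power_mult_distrib)
  also have "(real n powr (1 - \<beta>)) ^ k = real n powr ((1 - \<beta>) * real k)"
    using assms by (simp add: powr_powr flip: powr_realpow)
  finally show ?thesis .
qed

lemma prob_pair_pmf_Times:
  "measure_pmf.prob (pair_pmf p q) (A \<times> B) = measure_pmf.prob p A * measure_pmf.prob q B"
proof -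
  have "measure_pmf.prob (pair_pmf p q) (A \<times> B)
      = measure_pmf.prob (pair_pmf p q) ((A \<inter> set_pmf p) \<times> (B \<inter> set_pmf q))"
    by (subst measure_Int_set_pmf[symmetric]) (simp add: Times_Int_Times)
  then show ?thesis
    by (simp add: measure_pmf_prob_product countable_Int2 measure_Int_set_pmf)
qed

lemma prob_replicate_pmf_avoids:
  "measure_pmf.prob (replicate_pmf m p) {xs. x \<notin> set xs} = (1 - pmf p x) ^ m"
proof (induction m)
  case (Suc m)
  have "replicate_pmf (Suc m) p = map_pmf (\<lambda>(y, ys). y # ys) (pair_pmf p (replicate_pmf m p))"
    by (simp add: pair_pmf_def map_bind_pmf bind_return_pmf map_pmf_def bind_assoc_pmf)
  then have "measure_pmf.prob (replicate_pmf (Suc m) p) {xs. x \<notin> set xs}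
      = measure_pmf.prob (pair_pmf p (replicate_pmf m p)) ((- {x}) \<times> {xs. x \<notin> set xs})"
    by (auto intro!: arg_cong[where f = "measure _"])
  also have "\<dots> = measure_pmf.prob p (- {x}) * (1 - pmf p x) ^ m"
    by (simp add: prob_pair_pmf_Times Suc.IH)
  also have "measure_pmf.prob p (- {x}) = 1 - pmf p x"
    using measure_pmf.prob_compl[of "{x}" p] by (simp add: Compl_eq_Diff_UNIV measure_pmf_single)
  finally show ?case by simp
qed simp

lemma clauses_mono: "n \<le> n' \<Longrightarrow> clauses n k \<subseteq> clauses n' k"
  by (fastforce simp: clauses_def image_subset_iff)

text \<open>The clause \<open>C\<close> stays fixed as \<open>n\<close> grows, so its weight is
  constant and one draw hits it with probability at least a constant over
  \<open>n powr ((1 - \<beta>) * k)\<close>. With \<open>m n\<close> independent draws, the chance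
  of missing it decays exponentially in a quantity that tends to infinity.\<close>

lemma prob_clause_missing_tendsto_0:
  assumes "0 \<le> \<beta>" "\<beta> < 1"
    and m: "(\<lambda>n. real (m n)) \<in> \<omega>(\<lambda>n. real n powr ((1 - \<beta>) * real k))"
    and C: "C \<in> clauses n\<^sub>0 k"
  shows "(\<lambda>n. measure_pmf.prob (scale_free_formula n (m n) k \<beta>) {F. C \<notin># F}) \<longlonglongrightarrow> 0"
proof -
  define g where "g n = real n powr ((1 - \<beta>) * real k)" for n :: nat
  \<comment> \<open>Chosen so that \<open>c / g n\<close> bounds the probability of drawing
    \<open>C\<close> from below, by the estimate of the total weight.\<close>
  define c where "c = clause_weight \<beta> C / (2 / (1 - \<beta>)) ^ k"
  have c: "c > 0"
    using clause_weight_pos[OF C] assms by (simp add: c_def)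
  have k: "k \<le> n\<^sub>0"
    using C card_mono[of "{1..n\<^sub>0}" "var ` C"] by (auto simp: clauses_def card_image)
  have g_pos: "eventually (\<lambda>n. g n > 0) sequentially"
    using eventually_gt_at_top[of 0] by eventually_elim (simp add: g_def)
  have "filterlim (\<lambda>n. norm (real (m n) / g n)) at_top sequentially"
    using m g_pos unfolding g_def[symmetric]
    by (intro smallomegaD_filterlim_at_top_norm) (auto elim: eventually_mono)
  then have "filterlim (\<lambda>n. c * (real (m n) / g n)) at_top sequentially"
    using c by (intro filterlim_tendsto_pos_mult_at_top[OF tendsto_const])
      (auto simp: g_def)
  then have lim: "(\<lambda>n. exp (- (c * (real (m n) / g n)))) \<longlonglongrightarrow> 0"
    by (intro filterlim_compose[OF exp_at_bot]) (simp add: filterlim_uminus_at_bot)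
  have "eventually (\<lambda>n. measure_pmf.prob (scale_free_formula n (m n) k \<beta>) {F. C \<notin># F}
      \<le> exp (- (c * (real (m n) / g n)))) sequentially"
    \<comment> \<open>From \<open>n\<^sub>0\<close> on, \<open>C\<close> is a clause over the
      \<open>n\<close> variables and \<open>k \<le> n\<close>, so the formula for the clause
      distribution applies.\<close>
    using g_pos eventually_ge_at_top[of n\<^sub>0]
  proof eventually_elim
    case (elim n)
    let ?p = "pmf (scale_free_clause n k \<beta>) C"
    let ?S = "\<Sum>D\<in>clauses n k. clause_weight \<beta> D"
    have n: "n > 0"
      using elim(1) by (cases n) (auto simp: g_def)
    have Cn: "C \<in> clauses n k" and kn: "k \<le> n"
      using C clauses_mono[OF elim(2)] k elim(2) by auto
    have S: "?S > 0"
      using Cn finite_clauses clause_weight_pos by (intro sum_pos) auto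
    have "c / g n = clause_weight \<beta> C / ((2 / (1 - \<beta>)) ^ k * g n)"
      by (simp add: c_def)
    also have "\<dots> \<le> clause_weight \<beta> C / ?S"
      using sum_clause_weight_le[OF assms(1,2), of n k] S n clause_weight_pos[OF Cn, of \<beta>] elim(1) assms
      by (intro divide_left_mono) (auto simp: g_def)
    also have "\<dots> = ?p"
      using Cn by (simp add: pmf_scale_free_clause[OF kn])
    finally have p: "c / g n \<le> ?p" .
    have "measure_pmf.prob (scale_free_formula n (m n) k \<beta>) {F. C \<notin># F} = (1 - ?p) ^ m n"
      by (simp add: scale_free_formula_def prob_replicate_pmf_avoids[symmetric] vimage_def)
    \<comment> \<open>This is \<open>1 - x \<le> exp (- x)\<close> at \<open>x = c / g n\<close>.
      Raising to a power needs a nonnegative base, hence the appeal to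
      \<open>pmf_le_1\<close>.\<close>
    also have "\<dots> \<le> exp (- (c / g n)) ^ m n"
      using p exp_ge_add_one_self[of "- (c / g n)"] pmf_le_1[of "scale_free_clause n k \<beta>" C]
      by (intro power_mono) linarith+
    also have "\<dots> = exp (- (c * (real (m n) / g n)))"
      by (simp flip: exp_of_nat_mult)
    finally show ?case .
  qed
  then show ?thesis
    by (intro tendsto_sandwich[OF _ _ tendsto_const lim]) auto
qed

text \<open>Every assignment falsifies the clause over the first \<open>k\<close> variables whose
  literals all disagree with it.\<close>

lemma unsatisfiable_if_all_clauses:
  assumes "clauses k k \<subseteq> set_mset F"
  shows "\<not> satisfiable F"
  unfolding satisfiable_def
proof
  assume "\<exists>\<sigma>. \<forall>C\<in>#F. \<exists>l\<in>C. lit_true \<sigma> l"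
  then obtain \<sigma> where \<sigma>: "\<forall>C\<in>#F. \<exists>l\<in>C. lit_true \<sigma> l" ..
  let ?l = "\<lambda>i. if \<sigma> i then Neg i else Pos i"
  have "?l ` {1..k} \<in> clauses k k"
  proof -
    have "inj_on ?l {1..k}"
      by (auto simp: inj_on_def split: if_splits)
    then have "card (?l ` {1..k}) = k"
      by (simp only: card_image) simp
    moreover have "inj_on var (?l ` {1..k})" "var ` ?l ` {1..k} \<subseteq> {1..k}"
      by (auto simp: inj_on_def)
    ultimately show ?thesis
      by (simp only: clauses_def mem_Collect_eq finite_imageI finite_atLeastAtMost simp_thms)
  qed
  then obtain i where "lit_true \<sigma> (?l i)"
    using bspec[OF \<sigma> subsetD[OF assms]] by (metis (no_types, lifting) imageE)
  then show False by (cases "\<sigma> i") simp_all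
qed

theorem theorem5:
  fixes k :: nat and \<beta> :: real and m :: "nat \<Rightarrow> nat"
  assumes "k \<ge> 1"
    and "0 \<le> \<beta>" and "\<beta> < 1"
    and "(\<lambda>n. real (m n)) \<in> \<omega>(\<lambda>n. real n powr ((1 - \<beta>) * real k))"
  shows "(\<lambda>n. measure_pmf.prob (scale_free_formula n (m n) k \<beta>) {F. \<not> satisfiable F}) \<longlonglongrightarrow> 1"
proof -
  let ?P = "\<lambda>n. measure_pmf.prob (scale_free_formula n (m n) k \<beta>)"
  let ?missing = "\<lambda>n. \<Sum>C\<in>clauses k k. ?P n {F. C \<notin># F}"
  \<comment> \<open>The index set is finite and independent of \<open>n\<close>, so the limit may be
    taken term by term, with \<open>k\<close> in the role of \<open>n\<^sub>0\<close>.\<close>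
  have "?missing \<longlonglongrightarrow> (\<Sum>C\<in>clauses k k. 0)"
    by (intro tendsto_sum prob_clause_missing_tendsto_0[OF assms(2-4)])
  then have lim: "(\<lambda>n. 1 - ?missing n) \<longlonglongrightarrow> 1"
    using tendsto_diff[OF tendsto_const[of 1]] by fastforce
  \<comment> \<open>Union bound over the missing clauses. It holds for any distribution, so small
    \<open>n\<close>, where the clause distribution is a junk value, need no exception.\<close>
  have lower: "1 - ?missing n \<le> ?P n {F. \<not> satisfiable F}" for n
  proof -
    have "?P n {F. satisfiable F} \<le> ?P n (\<Union>C\<in>clauses k k. {F. C \<notin># F})"
      using unsatisfiable_if_all_clauses by (intro measure_pmf.finite_measure_mono) auto
    also have "\<dots> \<le> ?missing n"
      using finite_clauses by (intro measure_pmf.finite_measure_subadditive_finite) auto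
    moreover have "?P n {F. \<not> satisfiable F} = 1 - ?P n {F. satisfiable F}"
      using measure_pmf.prob_compl[of "{F. satisfiable F}" "scale_free_formula n (m n) k \<beta>"]
      by (simp add: set_diff_eq)
    ultimately show ?thesis by linarith
  qed
  show ?thesis
    by (rule tendsto_sandwich[OF _ _ lim tendsto_const]) (auto simp: lower)
qed

end
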